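(* Let $\mathcal{M}_W=(S,P,W)$ be a finite, irreducible and aperiodic WDTMC with initial state $s_{\mathrm{init}}$, edge set $\mathcal{E}$ and stationary distribution $\rho^*$. Let $W_{\mathcal{E}}=\sum_{e=(s,s')\in\mathcal{E}}\rho^*(s)P(s,s')W(e)$ be its effective weight. Then $\mathcal{M}_W$ is almost surely convergent if and only if $W_{\mathcal{E}}<0$.
   Context: A DTMC is a pair $(S,P)$ with $P$ assigning to each $s\in S$ a probability distribution on $S$; write $P(s,s')=P(s)(s')$. Edges are pairs $(s,s')$ with $P(s,s')>0$; $\mathcal{E}$ is the set of edges. A weighted DTMC (WDTMC) is $(S,P,W)$ with $W$ a weight function on $\mathcal{E}$ with values in $\mathbb{R}\cup\{+\infty\}$. An infinite path is a sequence $\sigma=\sigma_1,\sigma_2,\dots$ of states with $P(\sigma_i,\sigma_{i+1})>0$ for all $i$. All paths considered start at a fixed state $s_{\mathrm{init}}$, and $\Pr$ is the usual cylinder-set probability measure on infinite paths from $s_{\mathrm{init}}$. Irreducible and aperiodic have their standard meaning; the stationary distribution $\rho^*$ is the unique distribution on $S$ with $\rho^*(s)=\sum_{s'\in S}\rho^*(s')P(s',s)$ for all $s\in S$. The WDTMC is almost surely convergent if $\Pr\{\sigma : \lim_{n\to\infty}\sum_{i=1}^n W(\sigma_i,\sigma_{i+1})=-\infty\}=1$. *)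

theory Defs
  imports "HOL-Probability.Probability"
begin

definition dtmc :: "'s set \<Rightarrow> ('s \<Rightarrow> 's pmf) \<Rightarrow> bool" where
  "dtmc S P \<longleftrightarrow> (\<forall>s\<in>S. set_pmf (P s) \<subseteq> S)"

definition edges :: "'s set \<Rightarrow> ('s \<Rightarrow> 's pmf) \<Rightarrow> ('s \<times> 's) set" where
  "edges S P = {(s, s'). s \<in> S \<and> s' \<in> S \<and> 0 < pmf (P s) s'}"

text \<open>Weights are constrained on edges only; there they are real or \<open>\<infinity>\<close>.\<close>

definition wdtmc :: "'s set \<Rightarrow> ('s \<Rightarrow> 's pmf) \<Rightarrow> ('s \<times> 's \<Rightarrow> ereal) \<Rightarrow> bool" where
  "wdtmc S P W \<longleftrightarrow> dtmc S P \<and> (\<forall>e\<in>edges S P. W e \<noteq> -\<infinity>)"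

primrec n_step :: "('s \<Rightarrow> 's pmf) \<Rightarrow> nat \<Rightarrow> 's \<Rightarrow> 's pmf" where
  "n_step P 0 s = return_pmf s"
| "n_step P (Suc n) s = bind_pmf (P s) (n_step P n)"

definition irreducible_chain :: "'s set \<Rightarrow> ('s \<Rightarrow> 's pmf) \<Rightarrow> bool" where
  "irreducible_chain S P \<longleftrightarrow> (\<forall>s\<in>S. \<forall>s'\<in>S. \<exists>n. 0 < pmf (n_step P n s) s')"

definition aperiodic_chain :: "'s set \<Rightarrow> ('s \<Rightarrow> 's pmf) \<Rightarrow> bool" where
  "aperiodic_chain S P \<longleftrightarrow> (\<forall>s\<in>S. Gcd {n. 0 < n \<and> 0 < pmf (n_step P n s) s} = 1)"

text \<open>The sum is meant for finite \<open>S\<close>.\<close>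

definition stationary_distribution :: "'s set \<Rightarrow> ('s \<Rightarrow> 's pmf) \<Rightarrow> 's pmf \<Rightarrow> bool" where
  "stationary_distribution S P \<rho> \<longleftrightarrow>
     set_pmf \<rho> \<subseteq> S \<and> (\<forall>s\<in>S. pmf \<rho> s = (\<Sum>s'\<in>S. pmf \<rho> s' * pmf (P s') s))"

definition effective_weight ::
    "'s set \<Rightarrow> ('s \<Rightarrow> 's pmf) \<Rightarrow> ('s \<times> 's \<Rightarrow> ereal) \<Rightarrow> 's pmf \<Rightarrow> ereal" where
  "effective_weight S P W \<rho> =
     (\<Sum>(s, s')\<in>edges S P. ereal (pmf \<rho> s * pmf (P s) s') * W (s, s'))"

text \<open>Paths are indexed from \<open>0\<close>.\<close>

definition paths :: "'s set \<Rightarrow> ('s \<Rightarrow> 's pmf) \<Rightarrow> 's \<Rightarrow> (nat \<Rightarrow> 's) set" where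
  "paths S P s0 = {\<sigma>. \<sigma> 0 = s0 \<and> (\<forall>i. (\<sigma> i, \<sigma> (Suc i)) \<in> edges S P)}"

text \<open>
  The law of the chain on state sequences is obtained by the Ionescu-Tulcea extension from the
  kernels that draw state \<open>0\<close> as \<open>s0\<close> and state \<open>Suc n\<close> from \<open>P\<close> at state \<open>n\<close>.
  The lemma \<open>emeasure_path_measure_cylinder\<close> below gives its values on cylinder sets.
\<close>

definition step_kernel :: "('s \<Rightarrow> 's pmf) \<Rightarrow> 's \<Rightarrow> nat \<Rightarrow> (nat \<Rightarrow> 's) \<Rightarrow> 's measure" where
  "step_kernel P s0 i \<omega> = measure_pmf (case i of 0 \<Rightarrow> return_pmf s0 | Suc n \<Rightarrow> P (\<omega> n))"

definition path_measure :: "('s \<Rightarrow> 's pmf) \<Rightarrow> 's \<Rightarrow> (nat \<Rightarrow> 's) measure" where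
  "path_measure P s0 =
     projective_family.lim UNIV
       (Ionescu_Tulcea.CI (step_kernel P s0) (\<lambda>_. count_space UNIV)) (\<lambda>_. count_space UNIV)"

lemma Ionescu_Tulcea_step_kernel:
  "Ionescu_Tulcea (step_kernel P s0) (\<lambda>_. count_space UNIV)"
proof (rule Ionescu_Tulcea.intro)
  fix i
  show "step_kernel P s0 i
      \<in> measurable (PiM {0..<i} (\<lambda>_. count_space UNIV)) (subprob_algebra (count_space UNIV))"
  proof (cases i)
    case 0
    then show ?thesis
      by (auto simp: step_kernel_def[abs_def] measure_pmf_in_subprob_algebra)
  next
    case (Suc n)
    have "(\<lambda>\<omega>. \<omega> n) \<in> measurable (PiM {0..<i} (\<lambda>_. count_space UNIV)) (count_space UNIV)"
      using Suc by (intro measurable_component_singleton) auto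
    moreover have "(\<lambda>s. measure_pmf (P s))
        \<in> measurable (count_space UNIV) (subprob_algebra (count_space UNIV))"
      by (simp add: measure_pmf_in_subprob_algebra)
    ultimately show ?thesis
      using Suc by (auto simp: step_kernel_def[abs_def] intro: measurable_compose)
  qed
next
  show "prob_space (step_kernel P s0 i \<omega>)" for i \<omega>
    by (simp add: step_kernel_def measure_pmf.prob_space_axioms)
qed

lemma sets_path_measure [simp, measurable_cong]:
  "sets (path_measure P s0) = sets (PiM UNIV (\<lambda>_. count_space UNIV))"
proof -
  interpret Ionescu_Tulcea "step_kernel P s0" "\<lambda>_. count_space UNIV"
    by (rule Ionescu_Tulcea_step_kernel)
  show ?thesis by (simp add: path_measure_def)
qed

lemma space_path_measure [simp]: "space (path_measure P s0) = UNIV"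
  using sets_eq_imp_space_eq[OF sets_path_measure, of P s0] by (simp add: space_PiM)

lemma emeasure_path_measure_cylinder:
  "emeasure (path_measure P s0) {\<sigma>. \<forall>i\<le>n. \<sigma> i = x i} =
     ennreal (if x 0 = s0 then \<Prod>i<n. pmf (P (x i)) (x (Suc i)) else 0)"
proof -
  let ?M = "\<lambda>_::nat. count_space (UNIV :: 'a set)"
  interpret Ionescu_Tulcea "step_kernel P s0" ?M
    by (rule Ionescu_Tulcea_step_kernel)
  let ?X = "\<lambda>n. {restrict x {0..<n}}"
  have X: "?X n \<in> sets (PiM {0..<n} ?M)" for n
  proof -
    have "?X n = (\<Pi>\<^sub>E i\<in>{0..<n}. {x i})"
      by (auto simp: PiE_iff extensional_def restrict_def fun_eq_iff)
    then show ?thesis by (simp add: sets_PiM_I_finite del: PiE_singleton)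
  qed
  have step: "emeasure (eP n \<omega>) (?X (Suc n)) =
      indicator (?X n) \<omega> * ennreal (pmf (case n of 0 \<Rightarrow> return_pmf s0 | Suc m \<Rightarrow> P (x m)) (x n))"
    if \<omega>: "\<omega> \<in> space (PiM {0..<n} ?M)" for n \<omega>
  proof -
    have ext: "\<omega> \<in> extensional {0..<n}"
      using \<omega> by (auto simp: space_PiM PiE_iff)
    have "fun_upd \<omega> n -` ?X (Suc n) \<inter> space (?M n) = (if \<omega> \<in> ?X n then {x n} else {})"
    proof -
      have "fun_upd \<omega> n y = restrict x {0..<Suc n} \<longleftrightarrow> y = x n \<and> \<omega> = restrict x {0..<n}" for y
      proof
        assume *: "fun_upd \<omega> n y = restrict x {0..<Suc n}"
        have "y = x n" using fun_cong[OF *, of n] by simp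
        moreover have "\<omega> i = restrict x {0..<n} i" for i
          using fun_cong[OF *, of i] ext
          by (cases "i = n") (auto simp: restrict_def extensional_def split: if_splits)
        ultimately show "y = x n \<and> \<omega> = restrict x {0..<n}" by auto
      qed (auto simp: fun_eq_iff restrict_def)
      then show ?thesis by auto
    qed
    then have "emeasure (eP n \<omega>) (?X (Suc n)) =
        emeasure (step_kernel P s0 n \<omega>) (if \<omega> \<in> ?X n then {x n} else {})"
      using emeasure_eP[OF \<omega> X] by simp
    then show ?thesis
      by (auto simp: step_kernel_def emeasure_pmf_single split: nat.split)
  qed
  have C: "emeasure (C 0 (Suc n) (\<lambda>_. undefined)) (?X (Suc n)) =
      ennreal (if x 0 = s0 then \<Prod>i<n. pmf (P (x i)) (x (Suc i)) else 0)" for n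
  proof -
    have sp: "(\<lambda>_. undefined) \<in> space (PiM {0..<0} ?M)" by (simp add: space_PiM)
    have rec: "emeasure (C 0 (Suc n) (\<lambda>_. undefined)) (?X (Suc n)) =
        emeasure (C 0 n (\<lambda>_. undefined)) (?X n) *
        ennreal (pmf (case n of 0 \<Rightarrow> return_pmf s0 | Suc m \<Rightarrow> P (x m)) (x n))" for n
    proof -
      have ne: "space (C 0 n (\<lambda>_. undefined)) \<noteq> {}"
        using prob_space.not_empty[OF prob_space_C[OF sp, of n]] .
      have m: "eP n \<in> measurable (C 0 n (\<lambda>_. undefined)) (subprob_algebra (PiM {0..<Suc n} ?M))"
        using measurable_eP[of n]
        by (subst measurable_cong_sets[OF sets_C[OF sp, of n] refl]) simp
      have "emeasure (C 0 (Suc n) (\<lambda>_. undefined)) (?X (Suc n)) =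
          (\<integral>\<^sup>+\<omega>. emeasure (eP n \<omega>) (?X (Suc n)) \<partial>C 0 n (\<lambda>_. undefined))"
        using emeasure_bind[OF ne m X] by simp
      also have "\<dots> = (\<integral>\<^sup>+\<omega>. indicator (?X n) \<omega> *
          ennreal (pmf (case n of 0 \<Rightarrow> return_pmf s0 | Suc m \<Rightarrow> P (x m)) (x n))
          \<partial>C 0 n (\<lambda>_. undefined))"
        by (intro nn_integral_cong step) (simp add: space_C[OF sp])
      also have "\<dots> = emeasure (C 0 n (\<lambda>_. undefined)) (?X n) *
          ennreal (pmf (case n of 0 \<Rightarrow> return_pmf s0 | Suc m \<Rightarrow> P (x m)) (x n))"
      proof -
        have Xn: "?X n \<in> sets (C 0 n (\<lambda>_. undefined))"
          using X[of n] by (simp add: sets_C[OF sp])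
        show ?thesis
          by (subst nn_integral_multc)
             (simp_all only: borel_measurable_indicator[OF Xn] nn_integral_indicator[OF Xn])
      qed
      finally show ?thesis .
    qed
    show ?thesis
    proof (induction n)
      case 0
      have "emeasure (C 0 0 (\<lambda>_. undefined)) (?X 0) = 1"
        using X[of 0] by (simp add: restrict_def)
      then show ?case
        unfolding rec[of 0] by (simp add: indicator_def)
    next
      case (Suc n)
      show ?case
        unfolding rec[of "Suc n"] Suc.IH by (auto simp: ennreal_mult' prod_nonneg mult.commute)
    qed
  qed
  have "{\<sigma>. \<forall>i\<le>n. \<sigma> i = x i} = PF.emb UNIV {0..<Suc n} (?X (Suc n))"
    by (auto simp: prod_emb_def restrict_def fun_eq_iff less_Suc_eq_le) (metis)+
  then have "emeasure (path_measure P s0) {\<sigma>. \<forall>i\<le>n. \<sigma> i = x i} = emeasure (CI {0..<Suc n}) (?X (Suc n))"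
    using lim[OF _ X] by (simp add: path_measure_def)
  also have "\<dots> = emeasure (C 0 (Suc n) (\<lambda>_. undefined)) (PF.emb {0..<Suc n} {0..<Suc n} (?X (Suc n)))"
    by (rule emeasure_CI[OF order_refl X])
  also have "PF.emb {0..<Suc n} {0..<Suc n} (?X (Suc n)) = ?X (Suc n)"
    by (rule prod_emb_id) (simp add: PiE_iff)
  finally show ?thesis
    using C by simp
qed

definition almost_surely_convergent ::
    "'s set \<Rightarrow> ('s \<Rightarrow> 's pmf) \<Rightarrow> ('s \<times> 's \<Rightarrow> ereal) \<Rightarrow> 's \<Rightarrow> bool" where
  "almost_surely_convergent S P W s0 \<longleftrightarrow>
     measure (path_measure P s0)
       {\<sigma> \<in> paths S P s0. (\<lambda>n. \<Sum>i<n. W (\<sigma> i, \<sigma> (Suc i))) \<longlonglongrightarrow> -\<infinity>} = 1"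

end

theory Submission
  imports Defs "HOL-Library.Function_Algebras"
begin

text \<open>
  If some edge has weight \<open>\<infinity>\<close>, it is reached with positive probability, and both sides fail.
  Otherwise the weights are real. By irreducibility the Poisson equation has a solution \<open>f\<close>, and
  adding \<open>f t - f s\<close> to the weight of each edge \<open>(s, t)\<close> changes path sums only by a bounded
  amount while making the expected increment equal to the effective weight \<open>\<omega>\<close> in every state.
  If \<open>\<omega> < 0\<close>, then for small \<open>l > 0\<close> the expectation of \<open>exp (l * walk)\<close> decays geometrically, so
  \<open>exp (l * walk)\<close> is almost surely summable and the walk tends to \<open>-\<infinity>\<close>. If \<open>\<omega> \<ge> 0\<close> and the walk
  tended to \<open>-\<infinity>\<close> almost surely, then Fatou's lemma applied to the submartingale stopped when it
  first exceeds \<open>K\<close> would show that the walk almost surely exceeds every \<open>K\<close>, a contradiction.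
\<close>

section \<open>The Poisson equation\<close>

text \<open>The functions vanishing off \<open>S\<close> form a space \<open>V\<close> spanned by
  finitely many point masses, so \<open>V\<close> has a finite basis \<open>B\<close>. An injective
  \<open>T\<close> sends \<open>B\<close> to \<open>card B\<close> independent vectors of
  \<open>V\<close>. If \<open>h\<close> were outside their span, adding it would give
  \<open>card B + 1\<close> independent vectors in \<open>span B\<close>.\<close>

lemma injective_endomorphism_surj:
  fixes T :: "('a \<Rightarrow> real) \<Rightarrow> 'a \<Rightarrow> real"
  assumes fin: "finite S"
    and add: "\<And>f g. T (\<lambda>x. f x + g x) = (\<lambda>x. T f x + T g x)"
    and scale: "\<And>c f. T (\<lambda>x. c * f x) = (\<lambda>x. c * T f x)"
    and supp: "\<And>f x. x \<notin> S \<Longrightarrow> T f x = 0"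
    and inj: "\<And>f. (\<And>x. x \<notin> S \<Longrightarrow> f x = 0) \<Longrightarrow> (\<And>x. T f x = 0) \<Longrightarrow> f = (\<lambda>x. 0)"
    and h: "\<And>x. x \<notin> S \<Longrightarrow> h x = 0"
  shows "\<exists>f. T f = h"
proof -
  \<comment> \<open>Functions are made a vector space by passing this scaling to the locale
    \<open>vector_space\<close>; addition is pointwise.\<close>
  define s :: "real \<Rightarrow> ('a \<Rightarrow> real) \<Rightarrow> 'a \<Rightarrow> real" where "s = (\<lambda>c f x. c * f x)"
  interpret vector_space s
    by standard (auto simp: s_def fun_eq_iff algebra_simps)
  interpret T: Vector_Spaces.linear s s T
    by standard (use add scale in \<open>auto simp: s_def plus_fun_def\<close>)
  define V where "V = {f::'a \<Rightarrow> real. \<forall>x. x \<notin> S \<longrightarrow> f x = 0}"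
  define e where "e = (\<lambda>a x::'a. of_bool (x = a) :: real)"
  have subV: "subspace V"
    by (auto simp: V_def subspace_def) (auto simp: s_def)
  have V_span: "V \<subseteq> span (e ` S)"
  proof
    fix f assume "f \<in> V"
    have sum_app: "(\<Sum>a\<in>S. s (f a) (e a)) x = (\<Sum>a\<in>S. f a * e a x)" for x
      using fin by (induction S rule: finite_induct) (auto simp: s_def)
    have "f = (\<Sum>a\<in>S. s (f a) (e a))"
      unfolding fun_eq_iff sum_app using \<open>f \<in> V\<close> fin
      by (auto simp: e_def V_def of_bool_def if_distrib[of "(*) _"] cong: if_cong)
    also have "\<dots> \<in> span (e ` S)"
      by (intro span_sum span_scale span_base) auto
    finally show "f \<in> span (e ` S)" .
  qed
  obtain B where B: "B \<subseteq> V" "independent B" "V \<subseteq> span B"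
    using maximal_independent_subset[of V] by blast
  have finB: "finite B"
    using independent_span_bound[of "e ` S" B] B V_span fin by auto
  have span_B: "span B = V"
    using B subV span_minimal[of B V] by blast
  have injT: "inj_on T (span B)"
    unfolding span_B
  proof (rule inj_onI)
    fix f g assume *: "f \<in> V" "g \<in> V" "T f = T g"
    have "f - g \<in> V" using * subV by (simp add: subspace_diff)
    moreover have "T (f - g) = 0" using * by (simp add: T.diff)
    ultimately have "f - g = (\<lambda>x. 0)"
      by (intro inj) (auto simp: V_def)
    then show "f = g" by (auto simp: fun_eq_iff)
  qed
  have ind: "independent (T ` B)"
    using T.independent_injective_image[OF B(2) injT] .
  have TV: "T f \<in> V" for f using supp by (auto simp: V_def)
  have hV: "h \<in> V" using h by (auto simp: V_def)
  have "h \<in> span (T ` B)"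
  proof (rule ccontr)
    assume "h \<notin> span (T ` B)"
    then have "independent (insert h (T ` B))"
      using ind by (rule independent_insertI)
    moreover have notin: "h \<notin> T ` B"
      using \<open>h \<notin> span (T ` B)\<close> span_base by blast
    ultimately have "card (insert h (T ` B)) \<le> card B"
      using independent_span_bound[OF finB] TV hV span_B by blast
    moreover have "card (T ` B) = card B"
      using injT by (intro card_image) (meson inj_on_subset span_superset)
    ultimately show False using notin finB by simp
  qed
  then show ?thesis
    using T.span_image[of B] by auto
qed

section \<open>Irreducible chains and the maximum principle\<close>

lemma n_step_induct:
  assumes "s' \<in> set_pmf (n_step P n s)" "A s"
    and "\<And>u v. A u \<Longrightarrow> v \<in> set_pmf (P u) \<Longrightarrow> A v"
  shows "A s'"
  using assms(1,2) by (induction n arbitrary: s) (auto intro: assms(3))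

locale finite_irreducible_chain =
  fixes S :: "'s set" and P :: "'s \<Rightarrow> 's pmf"
  assumes finite_S: "finite S" and nonempty: "S \<noteq> {}"
    and dtmc: "dtmc S P"
    and irreducible: "irreducible_chain S P"
begin

lemma set_P: "s \<in> S \<Longrightarrow> set_pmf (P s) \<subseteq> S"
  using dtmc by (auto simp: dtmc_def)

lemma sum_P: "s \<in> S \<Longrightarrow> (\<Sum>t\<in>S. pmf (P s) t) = 1"
  using set_P finite_S by (intro sum_pmf_eq_1)

lemma edges_iff: "(s, t) \<in> edges S P \<longleftrightarrow> s \<in> S \<and> t \<in> set_pmf (P s)"
  using set_P by (auto simp: edges_def pmf_positive_iff)

text \<open>The form in which irreducibility is used below: a property that passes along edges
  spreads from one state to all of \<open>S\<close>, with no step counts left.\<close>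

lemma irreducible_induct:
  assumes "s \<in> S" "t \<in> S" "A s"
    and step: "\<And>u v. u \<in> S \<Longrightarrow> A u \<Longrightarrow> v \<in> set_pmf (P u) \<Longrightarrow> A v"
  shows "A t"
proof -
  obtain n where "t \<in> set_pmf (n_step P n s)"
    using irreducible assms(1,2) by (auto simp: irreducible_chain_def pmf_positive_iff)
  then have "t \<in> S \<and> A t"
    by (rule n_step_induct[where A = "\<lambda>u. u \<in> S \<and> A u"]) (use assms set_P in blast)+
  then show ?thesis ..
qed

text \<open>Maximum principle: where \<open>f\<close> attains its maximum, its value is an average
  of values that are no larger, so every successor attains the maximum too. By irreducibility the
  maximum spreads over \<open>S\<close>.\<close>

lemma harmonic_imp_constant:
  fixes f :: "'s \<Rightarrow> real"
  assumes harm: "\<And>s. s \<in> S \<Longrightarrow> f s = (\<Sum>t\<in>S. pmf (P s) t * f t)"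
    and "s \<in> S" "t \<in> S"
  shows "f s = f t"
proof -
  obtain m where m: "m \<in> S" "\<And>s. s \<in> S \<Longrightarrow> f s \<le> f m"
    using finite_S nonempty obtains_MAX[of S f] by (metis Max_ge finite_imageI imageI)
  have "f u = f m" if "u \<in> S" for u
  proof (rule irreducible_induct[OF m(1) that, where A = "\<lambda>u. f u = f m"])
    fix u v assume u: "u \<in> S" "f u = f m" "v \<in> set_pmf (P u)"
    have "(\<Sum>t\<in>S. pmf (P u) t * (f m - f t)) = 0"
      using harm[OF u(1)] u(2) sum_P[OF u(1)]
      by (simp add: right_diff_distrib sum_subtractf flip: sum_distrib_right)
    then have "pmf (P u) v * (f m - f v) = 0"
      using m set_P[OF u(1)] u(3) finite_S by (subst (asm) sum_nonneg_eq_0_iff) auto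
    then show "f v = f m" using u(3) by (auto simp: set_pmf_iff)
  qed simp
  from this[OF \<open>s \<in> S\<close>] this[OF \<open>t \<in> S\<close>] show ?thesis by simp
qed

section \<open>Stationary distributions\<close>

context
  fixes \<rho> :: "'s pmf"
  assumes \<rho>: "stationary_distribution S P \<rho>"
begin

lemma stationary_subset: "set_pmf \<rho> \<subseteq> S"
  using \<rho> by (simp add: stationary_distribution_def)

lemma stationary_eq: "s \<in> S \<Longrightarrow> (\<Sum>r\<in>S. pmf \<rho> r * pmf (P r) s) = pmf \<rho> s"
  using \<rho> by (simp add: stationary_distribution_def)

text \<open>Positivity passes along an edge from \<open>u\<close> to \<open>v\<close>, because the
  mass at \<open>v\<close> is at least the flow \<open>pmf \<rho> u * pmf (P u) v\<close>. The start
  is any state of the support.\<close>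

lemma stationary_pos:
  assumes "s \<in> S" shows "pmf \<rho> s > 0"
proof -
  obtain r where r: "r \<in> set_pmf \<rho>" using set_pmf_not_empty by fast
  have "r \<in> S" using r stationary_subset by auto
  show ?thesis
  proof (rule irreducible_induct[OF \<open>r \<in> S\<close> assms, where A = "\<lambda>u. pmf \<rho> u > 0"])
    fix u v assume u: "u \<in> S" "pmf \<rho> u > 0" "v \<in> set_pmf (P u)"
    have "0 < pmf \<rho> u * pmf (P u) v" using u by (auto simp: pmf_positive_iff)
    also have "\<dots> \<le> (\<Sum>s'\<in>S. pmf \<rho> s' * pmf (P s') v)"
      using u finite_S by (intro member_le_sum) auto
    also have "\<dots> = pmf \<rho> v"
      using u set_P by (intro stationary_eq) auto
    finally show "pmf \<rho> v > 0" .
  qed (use r in \<open>simp add: pmf_positive_iff\<close>)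
qed

lemma stationary_sum:
  fixes f :: "'s \<Rightarrow> real"
  shows "(\<Sum>s\<in>S. pmf \<rho> s * (\<Sum>t\<in>S. pmf (P s) t * f t)) = (\<Sum>t\<in>S. pmf \<rho> t * f t)"
proof -
  have "(\<Sum>s\<in>S. pmf \<rho> s * (\<Sum>t\<in>S. pmf (P s) t * f t)) =
      (\<Sum>t\<in>S. \<Sum>s\<in>S. pmf \<rho> s * pmf (P s) t * f t)"
    unfolding sum_distrib_left by (subst sum.swap) (simp add: mult.assoc)
  also have "\<dots> = (\<Sum>t\<in>S. pmf \<rho> t * f t)"
    by (simp add: stationary_eq flip: sum_distrib_right)
  finally show ?thesis .
qed

text \<open>With \<open>h\<close> the centred function \<open>g - \<mu> g\<close>, the equation
  reads \<open>f - P f = h\<close>. It is solved through the operator \<open>T\<close>, which agrees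
  with \<open>f - P f\<close> where \<open>\<mu> f = 0\<close>. In the kernel of \<open>T\<close> a
  function has mean 0 and is harmonic, hence constant, hence 0 on \<open>S\<close>.\<close>

lemma poisson_equation:
  fixes g :: "'s \<Rightarrow> real"
  shows "\<exists>f. \<forall>s\<in>S. g s + (\<Sum>t\<in>S. pmf (P s) t * f t) - f s = (\<Sum>t\<in>S. pmf \<rho> t * g t)"
proof -
  define \<mu> where "\<mu> f = (\<Sum>t\<in>S. pmf \<rho> t * f t)" for f :: "'s \<Rightarrow> real"
  txt \<open>The summand \<open>\<mu> f\<close> makes \<open>T\<close> injective: without it constants are in the kernel.\<close>
  define T where "T = (\<lambda>f s. if s \<in> S then f s - (\<Sum>t\<in>S. pmf (P s) t * f t) + \<mu> f else 0)"
  have \<rho>1: "(\<Sum>t\<in>S. pmf \<rho> t) = 1"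
    using stationary_subset finite_S by (intro sum_pmf_eq_1)
  have \<mu>_const: "\<mu> (\<lambda>s. c) = c" for c
    by (simp add: \<mu>_def \<rho>1 flip: sum_distrib_right)
  \<comment> \<open>By stationarity \<open>f\<close> and \<open>P f\<close> have the same mean and
    cancel. So the mean of a solution of \<open>T f = h\<close> is that of \<open>h\<close>, namely
    0, and the extra summand of \<open>T\<close> disappears from the solved equation.\<close>
  have \<mu>_T: "\<mu> (T f) = \<mu> f" for f
  proof -
    have "\<mu> (T f) = (\<Sum>s\<in>S. pmf \<rho> s * f s - pmf \<rho> s * (\<Sum>t\<in>S. pmf (P s) t * f t) + pmf \<rho> s * \<mu> f)"
      unfolding \<mu>_def[of "T f"] by (intro sum.cong) (auto simp: T_def algebra_simps)
    also have "\<dots> = \<mu> f"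
      using stationary_sum[of f]
      by (simp add: sum.distrib sum_subtractf \<rho>1 \<mu>_def flip: sum_distrib_right)
    finally show ?thesis .
  qed
  define h where "h = (\<lambda>s. if s \<in> S then g s - \<mu> g else 0)"
  have \<mu>_h: "\<mu> h = 0"
  proof -
    have "\<mu> h = (\<Sum>s\<in>S. pmf \<rho> s * g s - pmf \<rho> s * \<mu> g)"
      unfolding \<mu>_def[of h] by (intro sum.cong) (auto simp: h_def algebra_simps)
    then show ?thesis
      by (simp add: sum_subtractf \<rho>1 \<mu>_def flip: sum_distrib_right)
  qed
  have "\<exists>f. T f = h"
  proof (rule injective_endomorphism_surj[OF finite_S])
    fix f assume f: "\<And>x. x \<notin> S \<Longrightarrow> f x = 0" and Tf: "\<And>x. T f x = 0"
    have \<mu>f: "\<mu> f = 0"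
      using \<mu>_T[of f] Tf by (simp add: \<mu>_def)
    have "f s = (\<Sum>t\<in>S. pmf (P s) t * f t)" if "s \<in> S" for s
      using Tf[of s] that \<mu>f by (simp add: T_def)
    then have const: "f s = f t" if "s \<in> S" "t \<in> S" for s t
      using harmonic_imp_constant that by blast
    obtain r where r: "r \<in> S" using nonempty by auto
    have "\<mu> f = \<mu> (\<lambda>_. f r)"
      unfolding \<mu>_def by (intro sum.cong refl arg_cong2[of _ _ _ _ "(*)"] const r)
    then have "f r = 0" using \<mu>f \<mu>_const by simp
    then show "f = (\<lambda>x. 0)" using const r f by (metis (no_types))
  qed (auto simp: T_def \<mu>_def h_def fun_eq_iff algebra_simps sum.distrib sum_distrib_left)
  then obtain f where f: "T f = h" ..
  have "\<mu> f = 0" using \<mu>_T[of f] \<mu>_h f by simp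
  then have "g s + (\<Sum>t\<in>S. pmf (P s) t * f t) - f s = \<mu> g" if "s \<in> S" for s
    using fun_cong[OF f, of s] that by (simp add: T_def h_def)
  then show ?thesis by (auto simp: \<mu>_def)
qed

end

end


section \<open>The Markov property of the path measure\<close>

text \<open>The whole space is the cylinder over the empty set of coordinates, so its mass is that
  of the marginal \<open>CI {}\<close>.\<close>

lemma prob_space_path_measure: "prob_space (path_measure P s0)"
proof -
  interpret Ionescu_Tulcea "step_kernel P s0" "\<lambda>_. count_space UNIV"
    by (rule Ionescu_Tulcea_step_kernel)
  let ?X = "space (PiM {} (\<lambda>_::nat. count_space (UNIV :: 'a set)))"
  have "PF.emb UNIV {} ?X = UNIV"
    by (auto simp: prod_emb_def space_PiM)
  then have "emeasure (path_measure P s0) UNIV = emeasure (CI {}) ?X"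
    using lim[of "{}" ?X] by (simp add: path_measure_def)
  also have "\<dots> = 1"
    using prob_space.emeasure_space_1[OF PF.prob_space_P[of "{}"]] by (simp add: PF.space_P)
  finally show ?thesis by (intro prob_spaceI) simp
qed

lemma measurable_path_coordinate [measurable]:
  "(\<lambda>\<sigma>. \<sigma> i) \<in> measurable (path_measure P s0) (count_space UNIV)"
  by (simp add: measurable_cong_sets[OF sets_path_measure refl])

lemma cylinder_in_sets: "{\<sigma>. \<forall>i\<le>n. \<sigma> i = x i} \<in> sets (path_measure P s0)"
proof -
  have "{\<sigma> \<in> space (path_measure P s0). \<forall>i\<le>n. \<sigma> i = x i} \<in> sets (path_measure P s0)"
    by measurable
  then show ?thesis by simp
qed

text \<open>An elementary form of being determined by the history up to time \<open>n\<close>. The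
  value type is arbitrary, so that \<open>F\<close> may return a function of the next state, as in
  \<open>markov_property\<close>.\<close>

definition adapted :: "nat \<Rightarrow> ((nat \<Rightarrow> 's) \<Rightarrow> 'b) \<Rightarrow> bool" where
  "adapted n F \<longleftrightarrow> (\<forall>\<sigma> \<tau>. (\<forall>i\<le>n. \<sigma> i = \<tau> i) \<longrightarrow> F \<sigma> = F \<tau>)"

lemma adaptedD: "adapted n F \<Longrightarrow> (\<And>i. i \<le> n \<Longrightarrow> \<sigma> i = \<tau> i) \<Longrightarrow> F \<sigma> = F \<tau>"
  by (auto simp: adapted_def)

section \<open>Finite prefixes of paths and their probabilities\<close>

locale started_chain = finite_irreducible_chain S P for S :: "'s set" and P +
  fixes s0 :: 's assumes s0: "s0 \<in> S"
begin

sublocale path: prob_space "path_measure P s0"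
  by (rule prob_space_path_measure)

abbreviation prefixes :: "nat \<Rightarrow> (nat \<Rightarrow> 's) set" where
  "prefixes n \<equiv> PiE {..n} (\<lambda>_. S)"

definition prefix_prob :: "nat \<Rightarrow> (nat \<Rightarrow> 's) \<Rightarrow> real" where
  "prefix_prob n x = (if x 0 = s0 then \<Prod>i<n. pmf (P (x i)) (x (Suc i)) else 0)"

lemma prefix_prob_nonneg: "prefix_prob n x \<ge> 0"
  by (auto simp: prefix_prob_def intro: prod_nonneg)

lemma finite_prefixes: "finite (prefixes n)"
  using finite_S by (intro finite_PiE) auto

lemma sum_prefixes_Suc:
  "(\<Sum>x\<in>prefixes (Suc n). F x) = (\<Sum>x\<in>prefixes n. \<Sum>t\<in>S. F (x(Suc n := t)))"
proof -
  have "(\<Sum>x\<in>prefixes (Suc n). F x) = (\<Sum>(t, x)\<in>S \<times> prefixes n. F (x(Suc n := t)))"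
    unfolding atMost_Suc PiE_insert_eq
    by (subst sum.reindex[OF inj_combinator]) (auto simp: case_prod_unfold)
  also have "\<dots> = (\<Sum>x\<in>prefixes n. \<Sum>t\<in>S. F (x(Suc n := t)))"
    by (subst sum.swap) (simp add: sum.cartesian_product)
  finally show ?thesis .
qed

lemma prefix_prob_Suc:
  "prefix_prob (Suc n) (x(Suc n := t)) = prefix_prob n x * pmf (P (x n)) t"
proof -
  have "(\<Prod>i<n. pmf (P ((x(Suc n := t)) i)) ((x(Suc n := t)) (Suc i))) =
      (\<Prod>i<n. pmf (P (x i)) (x (Suc i)))"
    by (intro prod.cong) auto
  then show ?thesis by (simp add: prefix_prob_def)
qed

lemma sum_prefix_prob: "(\<Sum>x\<in>prefixes n. prefix_prob n x) = 1"
proof (induction n)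
  case 0
  \<comment> \<open>Prefixes are \<open>undefined\<close> off their index set, so a prefix with the
    single index 0 is determined by one state.\<close>
  have "prefixes 0 = (\<lambda>t. (\<lambda>_. undefined)(0::nat := t)) ` S"
    using PiE_insert_eq[of "0::nat" "{}" "\<lambda>_. S"] by (simp add: atMost_0 image_image case_prod_unfold) force
  moreover have "inj_on (\<lambda>t. (\<lambda>_. undefined)(0::nat := t)) S"
    by (auto simp: inj_on_def dest: fun_cong[of _ _ 0])
  ultimately show ?case
    using s0 finite_S by (simp only: sum.reindex) (simp add: prefix_prob_def)
next
  case (Suc n)
  have "(\<Sum>x\<in>prefixes (Suc n). prefix_prob (Suc n) x) =
      (\<Sum>x\<in>prefixes n. prefix_prob n x * (\<Sum>t\<in>S. pmf (P (x n)) t))"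
    by (simp add: sum_prefixes_Suc prefix_prob_Suc sum_distrib_left)
  also have "\<dots> = (\<Sum>x\<in>prefixes n. prefix_prob n x)"
    by (intro sum.cong refl) (subst sum_P, auto)
  finally show ?case using Suc.IH by simp
qed

lemma disjoint_cylinders: "disjoint_family_on (\<lambda>x. {\<sigma>. \<forall>i\<le>n. \<sigma> i = x i}) (prefixes n)"
  unfolding disjoint_family_on_def
proof (intro ballI impI)
  fix x y assume xy: "x \<in> prefixes n" "y \<in> prefixes n" "x \<noteq> y"
  then obtain i where "i \<in> {..n}" "x i \<noteq> y i" by (meson PiE_ext)
  then show "{\<sigma>. \<forall>i\<le>n. \<sigma> i = x i} \<inter> {\<sigma>. \<forall>i\<le>n. \<sigma> i = y i} = {}" by auto
qed

text \<open>For each \<open>n\<close>, the finitely many prefixes in \<open>S\<close> of positive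
  probability already carry mass 1 by \<open>sum_prefix_prob\<close>, and each of them follows
  edges. The countably many \<open>n\<close> are then combined.\<close>

lemma AE_paths: "AE \<sigma> in path_measure P s0. \<sigma> \<in> paths S P s0"
proof -
  have "AE \<sigma> in path_measure P s0. \<sigma> 0 = s0 \<and> (\<sigma> n, \<sigma> (Suc n)) \<in> edges S P" for n
  proof -
    define A where "A = {x \<in> prefixes (Suc n). prefix_prob (Suc n) x > 0}"
    have A: "A \<subseteq> prefixes (Suc n)" "finite A"
      using finite_prefixes by (auto simp: A_def)
    let ?C = "\<lambda>x. {\<sigma>. \<forall>i\<le>Suc n. \<sigma> i = x i}"
    have "emeasure (path_measure P s0) (\<Union>x\<in>A. ?C x) =
        (\<Sum>x\<in>A. emeasure (path_measure P s0) (?C x))"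
      using A cylinder_in_sets disjoint_cylinders
      by (intro sum_emeasure[symmetric]) (auto intro: disjoint_family_on_mono)
    also have "\<dots> = (\<Sum>x\<in>A. ennreal (prefix_prob (Suc n) x))"
      by (simp add: emeasure_path_measure_cylinder prefix_prob_def)
    also have "\<dots> = ennreal (\<Sum>x\<in>A. prefix_prob (Suc n) x)"
      by (simp add: prefix_prob_nonneg)
    also have "(\<Sum>x\<in>A. prefix_prob (Suc n) x) = (\<Sum>x\<in>prefixes (Suc n). prefix_prob (Suc n) x)"
      using finite_prefixes prefix_prob_nonneg[of "Suc n"]
      by (intro sum.mono_neutral_left) (auto simp: A_def order.order_iff_strict)
    finally have "emeasure (path_measure P s0) (\<Union>x\<in>A. ?C x) = 1"
      by (simp add: sum_prefix_prob)
    then have "AE \<sigma> in path_measure P s0. \<sigma> \<in> (\<Union>x\<in>A. ?C x)"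
      by (intro path.AE_prob_1) (simp add: measure_def)
    then show ?thesis
    proof (rule AE_mp, intro AE_I2 impI)
      fix \<sigma> assume "\<sigma> \<in> (\<Union>x\<in>A. ?C x)"
      then obtain x where x: "x \<in> A" "\<And>i. i \<le> Suc n \<Longrightarrow> \<sigma> i = x i" by auto
      have pos: "prefix_prob (Suc n) x > 0" and mem: "x n \<in> S"
        using x(1) by (auto simp: A_def PiE_iff)
      have "x 0 = s0" and "0 < (\<Prod>i<Suc n. pmf (P (x i)) (x (Suc i)))"
        using pos by (auto simp: prefix_prob_def split: if_splits)
      then have "pmf (P (x n)) (x (Suc n)) \<noteq> 0" by auto
      then show "\<sigma> 0 = s0 \<and> (\<sigma> n, \<sigma> (Suc n)) \<in> edges S P"
        using x(2)[of 0] x(2)[of n] x(2)[of "Suc n"] mem \<open>x 0 = s0\<close>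
        by (simp add: edges_iff set_pmf_iff)
    qed
  qed
  then have "AE \<sigma> in path_measure P s0. \<forall>n. \<sigma> 0 = s0 \<and> (\<sigma> n, \<sigma> (Suc n)) \<in> edges S P"
    by (simp add: AE_all_countable)
  then show ?thesis by (simp add: paths_def)
qed

lemma paths_in_S: "\<sigma> \<in> paths S P s0 \<Longrightarrow> \<sigma> i \<in> S"
  by (auto simp: paths_def edges_def)

text \<open>Almost every sequence lies in exactly one of the finitely many cylinders over
  \<open>prefixes n\<close>, and \<open>F\<close> is constant on each of them. So \<open>F\<close>
  agrees almost everywhere with a finite combination of indicators.\<close>

lemma nn_integral_adapted:
  assumes "adapted n F"
  shows "(\<integral>\<^sup>+\<sigma>. F \<sigma> \<partial>path_measure P s0) = (\<Sum>x\<in>prefixes n. F x * ennreal (prefix_prob n x))"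
proof -
  let ?C = "\<lambda>x. {\<sigma>. \<forall>i\<le>n. \<sigma> i = x i}"
  have "(\<integral>\<^sup>+\<sigma>. F \<sigma> \<partial>path_measure P s0) =
      (\<integral>\<^sup>+\<sigma>. (\<Sum>x\<in>prefixes n. F x * indicator (?C x) \<sigma>) \<partial>path_measure P s0)"
  proof (rule nn_integral_cong_AE, rule AE_mp[OF AE_paths], intro AE_I2 impI)
    fix \<sigma> assume \<sigma>: "\<sigma> \<in> paths S P s0"
    define x where "x = restrict \<sigma> {..n}"
    have x: "x \<in> prefixes n" using paths_in_S[OF \<sigma>] by (auto simp: x_def)
    have "\<sigma> \<in> ?C y \<longleftrightarrow> y = x" if "y \<in> prefixes n" for y
    proof
      assume "\<sigma> \<in> ?C y"
      then show "y = x" using x that by (intro PiE_ext) (auto simp: x_def)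
    qed (auto simp: x_def)
    then have "(\<Sum>y\<in>prefixes n. F y * indicator (?C y) \<sigma>) =
        (\<Sum>y\<in>prefixes n. if y = x then F y else 0)"
      by (intro sum.cong) (auto simp: indicator_def)
    also have "\<dots> = F x" using x finite_prefixes by simp
    also have "F x = F \<sigma>" using assms by (rule adaptedD) (auto simp: x_def)
    finally show "F \<sigma> = (\<Sum>y\<in>prefixes n. F y * indicator (?C y) \<sigma>)" ..
  qed
  also have "\<dots> = (\<Sum>x\<in>prefixes n. F x * emeasure (path_measure P s0) (?C x))"
    using cylinder_in_sets
    by (subst nn_integral_sum) (auto intro!: sum.cong nn_integral_cmult_indicator)
  also have "\<dots> = (\<Sum>x\<in>prefixes n. F x * ennreal (prefix_prob n x))"
    by (simp add: emeasure_path_measure_cylinder prefix_prob_def)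
  finally show ?thesis .
qed

text \<open>Conditioning on the history up to time \<open>n\<close>, written as an identity of
  integrals. Both sides become finite sums over prefixes; on the left the last state splits off with
  the factor \<open>pmf (P (x n)) t\<close>.\<close>

lemma markov_property:
  fixes H :: "(nat \<Rightarrow> 's) \<Rightarrow> 's \<Rightarrow> ennreal"
  assumes H: "adapted n H"
  shows "(\<integral>\<^sup>+\<sigma>. H \<sigma> (\<sigma> (Suc n)) \<partial>path_measure P s0) =
    (\<integral>\<^sup>+\<sigma>. (\<Sum>t\<in>S. ennreal (pmf (P (\<sigma> n)) t) * H \<sigma> t) \<partial>path_measure P s0)"
proof -
  have upd: "H (x(Suc n := t)) = H x" for x t
    by (rule adaptedD[OF H]) auto
  have "adapted (Suc n) (\<lambda>\<sigma>. H \<sigma> (\<sigma> (Suc n)))"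
    unfolding adapted_def
  proof (intro allI impI)
    fix \<sigma> \<tau> :: "nat \<Rightarrow> 's" assume eq: "\<forall>i\<le>Suc n. \<sigma> i = \<tau> i"
    have "H \<sigma> = H \<tau>" using eq by (intro adaptedD[OF H]) auto
    then show "H \<sigma> (\<sigma> (Suc n)) = H \<tau> (\<tau> (Suc n))" using eq by simp
  qed
  then have "(\<integral>\<^sup>+\<sigma>. H \<sigma> (\<sigma> (Suc n)) \<partial>path_measure P s0) =
      (\<Sum>x\<in>prefixes n. \<Sum>t\<in>S. H x t * ennreal (prefix_prob n x * pmf (P (x n)) t))"
    by (simp add: nn_integral_adapted sum_prefixes_Suc prefix_prob_Suc upd)
  also have "\<dots> = (\<Sum>x\<in>prefixes n. (\<Sum>t\<in>S. ennreal (pmf (P (x n)) t) * H x t) * ennreal (prefix_prob n x))"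
    by (simp add: ennreal_mult prefix_prob_nonneg sum_distrib_left sum_distrib_right mult_ac)
  also have "\<dots> = (\<integral>\<^sup>+\<sigma>. (\<Sum>t\<in>S. ennreal (pmf (P (\<sigma> n)) t) * H \<sigma> t) \<partial>path_measure P s0)"
  proof (rule nn_integral_adapted[symmetric])
    show "adapted n (\<lambda>\<sigma>. \<Sum>t\<in>S. ennreal (pmf (P (\<sigma> n)) t) * H \<sigma> t)"
      unfolding adapted_def
    proof (intro allI impI)
      fix \<sigma> \<tau> :: "nat \<Rightarrow> 's" assume eq: "\<forall>i\<le>n. \<sigma> i = \<tau> i"
      have "H \<sigma> = H \<tau>" using eq by (intro adaptedD[OF H]) auto
      then show "(\<Sum>t\<in>S. ennreal (pmf (P (\<sigma> n)) t) * H \<sigma> t) =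
          (\<Sum>t\<in>S. ennreal (pmf (P (\<tau> n)) t) * H \<tau> t)" using eq by simp
    qed
  qed
  finally show ?thesis .
qed


section \<open>Walks with constant drift\<close>

definition walk :: "('s \<Rightarrow> 's \<Rightarrow> real) \<Rightarrow> nat \<Rightarrow> (nat \<Rightarrow> 's) \<Rightarrow> real" where
  "walk y n \<sigma> = (\<Sum>i<n. y (\<sigma> i) (\<sigma> (Suc i)))"

lemma walk_Suc: "walk y (Suc n) \<sigma> = walk y n \<sigma> + y (\<sigma> n) (\<sigma> (Suc n))"
  by (simp add: walk_def)

lemma adapted_walk: "m \<le> n \<Longrightarrow> adapted n (walk y m)"
  by (auto simp: adapted_def walk_def intro!: sum.cong)

context
  fixes y :: "'s \<Rightarrow> 's \<Rightarrow> real"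
  assumes supp: "\<And>s t. s \<notin> S \<or> t \<notin> S \<Longrightarrow> y s t = 0"
begin

text \<open>On a large state type a function of two coordinates need not be measurable for the
  product sigma-algebra. Since \<open>y\<close> vanishes off the finite set
  \<open>S \<times> S\<close>, the increment is a finite sum of terms that each test single
  coordinates.\<close>

lemma measurable_increment [measurable]:
  "(\<lambda>\<sigma>. y (\<sigma> i) (\<sigma> (Suc i))) \<in> borel_measurable (path_measure P s0)"
proof -
  have "y (\<sigma> i) (\<sigma> (Suc i)) =
      (\<Sum>s\<in>S. \<Sum>t\<in>S. if \<sigma> i = s then if \<sigma> (Suc i) = t then y s t else 0 else 0)" for \<sigma>
  proof -
    have "(\<Sum>s\<in>S. \<Sum>t\<in>S. if \<sigma> i = s then if \<sigma> (Suc i) = t then y s t else 0 else 0) =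
        (\<Sum>s\<in>S. if \<sigma> i = s then if \<sigma> (Suc i) \<in> S then y s (\<sigma> (Suc i)) else 0 else 0)"
      using finite_S by (intro sum.cong) auto
    also have "\<dots> = y (\<sigma> i) (\<sigma> (Suc i))"
      using finite_S supp by auto
    finally show ?thesis ..
  qed
  then show ?thesis by simp
qed

lemma measurable_walk [measurable]: "walk y n \<in> borel_measurable (path_measure P s0)"
  unfolding walk_def by measurable

context
  fixes w :: real
  assumes drift: "\<And>s. s \<in> S \<Longrightarrow> (\<Sum>t\<in>S. pmf (P s) t * y s t) = w"
begin

section \<open>Negative drift: exponential moments\<close>

lemma negative_drift_walk:
  assumes "w < 0"
  shows "AE \<sigma> in path_measure P s0. filterlim (\<lambda>n. walk y n \<sigma>) at_bot sequentially"
proof -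
  let ?M = "path_measure P s0"
  \<comment> \<open>The moment generating function of the increment out of \<open>s\<close>. It is 1
    at 0 with derivative \<open>w < 0\<close> there, so it is below 1 just to the right of 0;
    finiteness of \<open>S\<close> allows one \<open>l\<close> for all states.\<close>
  define \<phi> where "\<phi> s l = (\<Sum>t\<in>S. pmf (P s) t * exp (l * y s t))" for s and l :: real
  have "\<forall>\<^sub>F l in at_right 0. \<phi> s l < 1" if s: "s \<in> S" for s
  proof -
    have "(\<phi> s has_real_derivative (\<Sum>t\<in>S. pmf (P s) t * y s t)) (at 0)"
      unfolding \<phi>_def by (auto intro!: derivative_eq_intros simp: mult_ac)
    then have "(\<phi> s has_real_derivative w) (at 0)" using drift[OF s] by simp
    from DERIV_neg_dec_right[OF this \<open>w < 0\<close>]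
    obtain d where "d > 0" "\<And>h. 0 < h \<Longrightarrow> h < d \<Longrightarrow> \<phi> s h < \<phi> s 0" by auto
    moreover have "\<phi> s 0 = 1" using sum_P[OF s] by (simp add: \<phi>_def)
    ultimately show ?thesis by (auto simp: eventually_at_right)
  qed
  then have "\<forall>\<^sub>F l in at_right 0. \<forall>s\<in>S. \<phi> s l < 1"
    using finite_S by (intro eventually_ball_finite) auto
  then have "\<forall>\<^sub>F l in at_right 0. l > 0 \<and> (\<forall>s\<in>S. \<phi> s l < 1)"
    using eventually_at_right_less by (rule eventually_conj[rotated])
  then obtain l where l: "l > 0" "\<And>s. s \<in> S \<Longrightarrow> \<phi> s l < 1"
    using eventually_happens'[OF trivial_limit_at_right_real] by blast
  define q where "q = Max ((\<lambda>s. \<phi> s l) ` S)"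
  have q: "\<phi> s l \<le> q" if "s \<in> S" for s
    using that finite_S by (auto simp: q_def)
  have "q < 1" unfolding q_def using finite_S s0 l by (subst Max_less_iff) auto
  have \<phi>_nonneg: "\<phi> s l \<ge> 0" for s by (auto simp: \<phi>_def intro!: sum_nonneg)
  have "q \<ge> 0" using q[OF s0] \<phi>_nonneg[of s0] by simp
  define E where "E n = (\<integral>\<^sup>+\<sigma>. ennreal (exp (l * walk y n \<sigma>)) \<partial>?M)" for n
  \<comment> \<open>Given the history up to time \<open>n\<close>, one more step multiplies the
    expectation by \<open>\<phi> (\<sigma> n) l\<close>, which is at most the worst factor
    \<open>q\<close>.\<close>
  have E: "E n \<le> ennreal (q ^ n)" for n
  proof (induction n)
    case 0
    show ?case using path.emeasure_space_1 by (simp add: E_def walk_def)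
  next
    case (Suc n)
    let ?H = "\<lambda>\<sigma> t. ennreal (exp (l * walk y n \<sigma>) * exp (l * y (\<sigma> n) t))"
    have "adapted n ?H"
      unfolding adapted_def
    proof (intro allI impI)
      fix \<sigma> \<tau> :: "nat \<Rightarrow> 's" assume eq: "\<forall>i\<le>n. \<sigma> i = \<tau> i"
      have "walk y n \<sigma> = walk y n \<tau>"
        using eq by (intro adaptedD[OF adapted_walk[OF order_refl]]) auto
      then show "?H \<sigma> = ?H \<tau>" using eq by simp
    qed
    have "E (Suc n) = (\<integral>\<^sup>+\<sigma>. ?H \<sigma> (\<sigma> (Suc n)) \<partial>?M)"
      by (simp add: E_def walk_Suc distrib_left exp_add)
    also have "\<dots> = (\<integral>\<^sup>+\<sigma>. (\<Sum>t\<in>S. ennreal (pmf (P (\<sigma> n)) t) * ?H \<sigma> t) \<partial>?M)"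
      by (rule markov_property[OF \<open>adapted n ?H\<close>])
    also have "\<dots> = (\<integral>\<^sup>+\<sigma>. ennreal (\<phi> (\<sigma> n) l * exp (l * walk y n \<sigma>)) \<partial>?M)"
      by (simp add: \<phi>_def sum_distrib_left mult_ac flip: ennreal_mult)
    also have "\<dots> \<le> (\<integral>\<^sup>+\<sigma>. ennreal q * ennreal (exp (l * walk y n \<sigma>)) \<partial>?M)"
    proof (rule nn_integral_mono_AE, rule AE_mp[OF AE_paths], intro AE_I2 impI)
      fix \<sigma> assume "\<sigma> \<in> paths S P s0"
      then have "\<phi> (\<sigma> n) l \<le> q" by (intro q paths_in_S)
      then show "ennreal (\<phi> (\<sigma> n) l * exp (l * walk y n \<sigma>)) \<le> ennreal q * ennreal (exp (l * walk y n \<sigma>))"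
        using \<open>q \<ge> 0\<close> by (simp flip: ennreal_mult add: ennreal_leI)
    qed
    also have "\<dots> = ennreal q * E n"
      unfolding E_def by (rule nn_integral_cmult) measurable
    also have "\<dots> \<le> ennreal q * ennreal (q ^ n)"
      using Suc.IH by (intro mult_left_mono) auto
    finally show ?case using \<open>q \<ge> 0\<close> by (simp add: ennreal_mult)
  qed
  \<comment> \<open>The expected sum is bounded by a geometric series, so the sum is almost surely
    finite. Its terms then tend to 0, which forces the walk to minus infinity because
    \<open>l > 0\<close>.\<close>
  have "(\<integral>\<^sup>+\<sigma>. (\<Sum>n. ennreal (exp (l * walk y n \<sigma>))) \<partial>?M) = (\<Sum>n. E n)"
    unfolding E_def by (rule nn_integral_suminf) measurable
  also have "\<dots> \<le> (\<Sum>n. ennreal (q ^ n))"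
    by (intro suminf_le E) auto
  also have "\<dots> < top"
    using \<open>q \<ge> 0\<close> \<open>q < 1\<close> by (subst top.not_eq_extremum[symmetric], intro ennreal_suminf_neq_top)
      (auto intro: summable_geometric)
  finally have "AE \<sigma> in ?M. (\<Sum>n. ennreal (exp (l * walk y n \<sigma>))) \<noteq> \<infinity>"
    by (intro nn_integral_PInf_AE) auto
  then show ?thesis
  proof (rule AE_mp, intro AE_I2 impI)
    fix \<sigma> assume "(\<Sum>n. ennreal (exp (l * walk y n \<sigma>))) \<noteq> \<infinity>"
    then have "summable (\<lambda>n. exp (l * walk y n \<sigma>))"
      by (intro summable_suminf_not_top) auto
    then have lim: "(\<lambda>n. exp (l * walk y n \<sigma>)) \<longlonglongrightarrow> 0"
      by (rule summable_LIMSEQ_zero)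
    show "filterlim (\<lambda>n. walk y n \<sigma>) at_bot sequentially"
      unfolding filterlim_at_bot
    proof
      fix Z
      have "\<forall>\<^sub>F n in sequentially. exp (l * walk y n \<sigma>) < exp (l * Z)"
        by (rule order_tendstoD(2)[OF lim]) simp
      then show "\<forall>\<^sub>F n in sequentially. walk y n \<sigma> \<le> Z"
        by eventually_elim (use \<open>l > 0\<close> in simp)
    qed
  qed
qed

text \<open>The stopped walk is a submartingale bounded by \<open>K + c\<close>, so its distance
  \<open>z\<close> to that bound is a nonnegative supermartingale of expectation at most
  \<open>K + c\<close>. On a path that never exceeds \<open>K\<close> while its walk tends to minus
  infinity, \<open>z\<close> tends to infinity; by Fatou this has probability 0.\<close>

lemma nonnegative_drift_walk_exceeds:
  assumes "w \<ge> 0" and K: "K \<ge> 0"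
    and lim: "AE \<sigma> in path_measure P s0. filterlim (\<lambda>n. walk y n \<sigma>) at_bot sequentially"
  shows "AE \<sigma> in path_measure P s0. \<exists>n. walk y n \<sigma> > K"
proof -
  let ?M = "path_measure P s0"
  \<comment> \<open>A crude bound on all increments, which limits the overshoot above
    \<open>K\<close> at the stopping time.\<close>
  define c where "c = (\<Sum>s\<in>S. \<Sum>t\<in>S. \<bar>y s t\<bar>)"
  have "c \<ge> 0" by (auto simp: c_def intro!: sum_nonneg)
  have y_le: "y s t \<le> c" for s t
  proof (cases "s \<in> S \<and> t \<in> S")
    case True
    have "y s t \<le> \<bar>y s t\<bar>" by simp
    also have "\<dots> \<le> (\<Sum>t\<in>S. \<bar>y s t\<bar>)" using True finite_S by (intro member_le_sum) auto
    also have "\<dots> \<le> c" unfolding c_def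
      using True finite_S by (intro member_le_sum[of s S "\<lambda>s. \<Sum>t\<in>S. \<bar>y s t\<bar>"]) (auto intro!: sum_nonneg)
    finally show ?thesis .
  qed (use supp \<open>c \<ge> 0\<close> in auto)
  txt \<open>\<open>v\<close> is the walk stopped at the first time it exceeds \<open>K\<close>.\<close>
  define b where "b n \<sigma> \<longleftrightarrow> (\<forall>k\<le>n. walk y k \<sigma> \<le> K)" for n \<sigma>
  define v where "v n \<sigma> = (\<Sum>i<n. of_bool (b i \<sigma>) * y (\<sigma> i) (\<sigma> (Suc i)))" for n \<sigma>
  have v_Suc: "v (Suc n) \<sigma> = v n \<sigma> + of_bool (b n \<sigma>) * y (\<sigma> n) (\<sigma> (Suc n))" for n \<sigma>
    by (simp add: v_def)
  \<comment> \<open>Every increment that is counted starts at a height of at most \<open>K\<close>,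
    so \<open>v\<close> cannot pass \<open>K + c\<close>.\<close>
  have v: "v n \<sigma> \<le> K + c \<and> ((\<forall>i<n. b i \<sigma>) \<longrightarrow> v n \<sigma> = walk y n \<sigma>)" for n \<sigma>
  proof (induction n)
    case 0
    show ?case using K \<open>c \<ge> 0\<close> by (simp add: v_def walk_def)
  next
    case (Suc n)
    show ?case
    proof (cases "b n \<sigma>")
      case True
      then have "\<forall>i<n. b i \<sigma>" by (auto simp: b_def)
      with Suc.IH have "v n \<sigma> = walk y n \<sigma>" by simp
      moreover have "walk y n \<sigma> \<le> K" using True by (auto simp: b_def)
      ultimately show ?thesis
        using True y_le[of "\<sigma> n" "\<sigma> (Suc n)"] by (simp add: v_Suc walk_Suc)
    next
      case False
      then show ?thesis using Suc.IH by (auto simp: v_Suc)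
    qed
  qed
  \<comment> \<open>Whether the step after time \<open>n\<close> is counted is decided by the states
    up to \<open>n\<close>, before that step is drawn. This is what \<open>markov_property\<close>
    requires.\<close>
  have adapted_v: "v n \<sigma> = v n \<tau>" and adapted_b: "b n \<sigma> = b n \<tau>"
    if eq: "\<And>i. i \<le> n \<Longrightarrow> \<sigma> i = \<tau> i" for n \<sigma> \<tau>
  proof -
    have "walk y k \<sigma> = walk y k \<tau>" if "k \<le> n" for k
      using eq that by (intro adaptedD[OF adapted_walk[OF order_refl]]) auto
    then have b: "b k \<sigma> = b k \<tau>" if "k \<le> n" for k
      using that by (auto simp: b_def)
    then show "v n \<sigma> = v n \<tau>" "b n \<sigma> = b n \<tau>"
      using eq by (auto simp: v_def intro!: sum.cong)
  qed
  have [measurable]: "Measurable.pred ?M (b n)" for n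
    unfolding b_def by measurable
  have [measurable]: "v n \<in> borel_measurable ?M" for n
    unfolding v_def by measurable
  define z where "z n \<sigma> = K + c - v n \<sigma>" for n \<sigma>
  have z_nonneg: "z n \<sigma> \<ge> 0" for n \<sigma> using v[of n \<sigma>] by (simp add: z_def)
  have [measurable]: "z n \<in> borel_measurable ?M" for n
    unfolding z_def by measurable
  have int_z: "(\<integral>\<^sup>+\<sigma>. ennreal (z n \<sigma>) \<partial>?M) \<le> ennreal (K + c)" for n
  proof (induction n)
    case 0
    show ?case using path.emeasure_space_1 by (simp add: z_def v_def)
  next
    case (Suc n)
    \<comment> \<open>The value of \<open>z (Suc n)\<close> if the next state were \<open>t\<close>.
      Its nonnegativity follows by replacing the state at \<open>Suc n\<close> with
      \<open>t\<close>, since \<open>z_nonneg\<close> holds for all sequences and not only for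
      paths.\<close>
    define h where "h \<sigma> t = z n \<sigma> - of_bool (b n \<sigma>) * y (\<sigma> n) t" for \<sigma> t
    have h_nonneg: "h \<sigma> t \<ge> 0" for \<sigma> t
    proof -
      have *: "v n (\<sigma>(Suc n := t)) = v n \<sigma>" "b n (\<sigma>(Suc n := t)) = b n \<sigma>"
        by (rule adapted_v adapted_b; simp)+
      have "h \<sigma> t = z (Suc n) (\<sigma>(Suc n := t))"
        by (simp add: h_def z_def v_Suc *)
      then show ?thesis using z_nonneg by simp
    qed
    have "adapted n (\<lambda>\<sigma> t. ennreal (h \<sigma> t))"
      unfolding adapted_def
    proof (intro allI impI)
      fix \<sigma> \<tau> :: "nat \<Rightarrow> 's" assume eq: "\<forall>i\<le>n. \<sigma> i = \<tau> i"
      have "v n \<sigma> = v n \<tau>" "b n \<sigma> = b n \<tau>"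
        using eq by (intro adapted_v adapted_b; simp)+
      then show "(\<lambda>t. ennreal (h \<sigma> t)) = (\<lambda>t. ennreal (h \<tau> t))"
        using eq by (simp add: h_def z_def)
    qed
    have "(\<integral>\<^sup>+\<sigma>. ennreal (z (Suc n) \<sigma>) \<partial>?M) = (\<integral>\<^sup>+\<sigma>. ennreal (h \<sigma> (\<sigma> (Suc n))) \<partial>?M)"
      by (simp add: h_def z_def v_Suc algebra_simps)
    also have "\<dots> = (\<integral>\<^sup>+\<sigma>. (\<Sum>t\<in>S. ennreal (pmf (P (\<sigma> n)) t) * ennreal (h \<sigma> t)) \<partial>?M)"
      by (rule markov_property[OF \<open>adapted n (\<lambda>\<sigma> t. ennreal (h \<sigma> t))\<close>])
    also have "\<dots> \<le> (\<integral>\<^sup>+\<sigma>. ennreal (z n \<sigma>) \<partial>?M)"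
    proof (rule nn_integral_mono_AE, rule AE_mp[OF AE_paths], intro AE_I2 impI)
      fix \<sigma> assume "\<sigma> \<in> paths S P s0"
      then have s: "\<sigma> n \<in> S" by (rule paths_in_S)
      have "(\<Sum>t\<in>S. pmf (P (\<sigma> n)) t * h \<sigma> t) =
          z n \<sigma> * (\<Sum>t\<in>S. pmf (P (\<sigma> n)) t) -
          of_bool (b n \<sigma>) * (\<Sum>t\<in>S. pmf (P (\<sigma> n)) t * y (\<sigma> n) t)"
        by (simp add: h_def right_diff_distrib sum_subtractf sum_distrib_left mult_ac)
      also have "\<dots> \<le> z n \<sigma>" using drift[OF s] sum_P[OF s] \<open>w \<ge> 0\<close> by simp
      finally show "(\<Sum>t\<in>S. ennreal (pmf (P (\<sigma> n)) t) * ennreal (h \<sigma> t)) \<le> ennreal (z n \<sigma>)"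
        by (simp add: h_nonneg ennreal_leI flip: ennreal_mult)
    qed
    also have "\<dots> \<le> ennreal (K + c)" by (rule Suc.IH)
    finally show ?case .
  qed
  have "(\<integral>\<^sup>+\<sigma>. liminf (\<lambda>n. ennreal (z n \<sigma>)) \<partial>?M) \<le> liminf (\<lambda>n. \<integral>\<^sup>+\<sigma>. ennreal (z n \<sigma>) \<partial>?M)"
    by (rule nn_integral_liminf) measurable
  also have "\<dots> \<le> ennreal (K + c)"
    using int_z by (intro Liminf_le) auto
  also have "\<dots> < top" by simp
  finally have "AE \<sigma> in ?M. liminf (\<lambda>n. ennreal (z n \<sigma>)) \<noteq> \<infinity>"
    by (intro nn_integral_PInf_AE) auto
  with lim show ?thesis
  proof eventually_elim
    fix \<sigma>
    assume bot: "filterlim (\<lambda>n. walk y n \<sigma>) at_bot sequentially"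
      and fin: "liminf (\<lambda>n. ennreal (z n \<sigma>)) \<noteq> \<infinity>"
    show "\<exists>n. walk y n \<sigma> > K"
    proof (rule ccontr)
      assume "\<not> ?thesis"
      then have "b n \<sigma>" for n by (auto simp: b_def not_less)
      then have "z n \<sigma> = K + c - walk y n \<sigma>" for n using v[of n \<sigma>] by (simp add: z_def)
      moreover have "filterlim (\<lambda>n. K + c - walk y n \<sigma>) at_top sequentially"
        unfolding diff_conv_add_uminus
        using bot by (intro filterlim_tendsto_add_at_top[OF tendsto_const])
          (simp add: filterlim_uminus_at_bot)
      ultimately have "(\<lambda>n. ennreal (z n \<sigma>)) \<longlonglongrightarrow> \<infinity>"
        using ennreal_tendsto_top_eq_at_top[of "\<lambda>n. z n \<sigma>"] z_nonneg by simp
      then have "liminf (\<lambda>n. ennreal (z n \<sigma>)) = \<infinity>"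
        by (intro lim_imp_Liminf) auto
      with fin show False by simp
    qed
  qed
qed

text \<open>A sequence tending to minus infinity is bounded above, but almost surely the walk would
  exceed all natural numbers \<open>K\<close> at once.\<close>

lemma nonnegative_drift_walk:
  assumes "w \<ge> 0"
  shows "\<not> (AE \<sigma> in path_measure P s0. filterlim (\<lambda>n. walk y n \<sigma>) at_bot sequentially)"
proof
  assume lim: "AE \<sigma> in path_measure P s0. filterlim (\<lambda>n. walk y n \<sigma>) at_bot sequentially"
  have "AE \<sigma> in path_measure P s0. \<forall>K::nat. \<exists>n. walk y n \<sigma> > K"
    unfolding AE_all_countable
    using nonnegative_drift_walk_exceeds[OF \<open>w \<ge> 0\<close> _ lim] by simp
  with lim have "AE \<sigma> in path_measure P s0. False"
  proof eventually_elim
    fix \<sigma>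
    assume bot: "filterlim (\<lambda>n. walk y n \<sigma>) at_bot sequentially"
      and exceeds: "\<forall>K::nat. \<exists>n. walk y n \<sigma> > K"
    obtain N where N: "\<And>n. n \<ge> N \<Longrightarrow> walk y n \<sigma> \<le> 0"
      using bot unfolding filterlim_at_bot eventually_sequentially by blast
    \<comment> \<open>Bounds the values before \<open>N\<close>; being nonnegative, it also bounds
      the later ones.\<close>
    define B where "B = (\<Sum>n<N. \<bar>walk y n \<sigma>\<bar>)"
    have "walk y n \<sigma> \<le> B" for n
    proof (cases "n < N")
      case True
      have "walk y n \<sigma> \<le> \<bar>walk y n \<sigma>\<bar>" by simp
      also have "\<dots> \<le> B" unfolding B_def using True by (intro member_le_sum) auto
      finally show ?thesis .
    next
      case False
      moreover have "B \<ge> 0" by (auto simp: B_def intro!: sum_nonneg)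
      ultimately show ?thesis using N[of n] by simp
    qed
    moreover obtain K :: nat where "B \<le> K" using real_arch_simple by blast
    ultimately show False using exceeds by (meson not_less order_trans)
  qed
  then show False by simp
qed

end

end

end


section \<open>Path weights\<close>

lemma filterlim_at_bot_bounded_diff:
  fixes a b :: "'a \<Rightarrow> real"
  assumes "filterlim a at_bot F" and diff: "\<And>x. \<bar>b x - a x\<bar> \<le> D"
  shows "filterlim b at_bot F"
  unfolding filterlim_at_bot
proof
  fix Z
  have "\<forall>\<^sub>F x in F. a x \<le> Z - D"
    using assms(1) by (simp add: filterlim_at_bot)
  then show "\<forall>\<^sub>F x in F. b x \<le> Z"
  proof eventually_elim
    fix x assume "a x \<le> Z - D"
    then show "b x \<le> Z" using diff[of x] by linarith
  qed
qed

context started_chain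
begin

lemma finite_edges: "finite (edges S P)"
  by (rule finite_subset[of _ "S \<times> S"]) (use finite_S in \<open>auto simp: edges_def\<close>)

text \<open>Quantifying over the finitely many edges reduces the edge condition to tests of single
  coordinates, which are measurable on any state type.\<close>

lemma paths_in_sets: "paths S P s0 \<in> sets (path_measure P s0)"
proof -
  have "paths S P s0 = {\<sigma> \<in> space (path_measure P s0). \<sigma> 0 = s0 \<and>
      (\<forall>i. \<exists>e\<in>edges S P. \<sigma> i = fst e \<and> \<sigma> (Suc i) = snd e)}"
    by (force simp: paths_def)
  also have "\<dots> \<in> sets (path_measure P s0)"
    using finite_edges by measurable
  finally show ?thesis .
qed

text \<open>Gives an explicit prefix, as the cylinder formula requires, in place of a positive
  \<open>n_step\<close> probability.\<close>

lemma reachable_from_start: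
  assumes "s \<in> S"
  shows "\<exists>n x. x n = s \<and> x 0 = s0 \<and> (\<forall>i<n. x (Suc i) \<in> set_pmf (P (x i)))"
proof (rule irreducible_induct[OF s0 assms,
      where A = "\<lambda>s. \<exists>n x. x n = s \<and> x 0 = s0 \<and> (\<forall>i<n. x (Suc i) \<in> set_pmf (P (x i)))"])
  show "\<exists>n x. x n = s0 \<and> x 0 = s0 \<and> (\<forall>i<n. x (Suc i) \<in> set_pmf (P (x i)))"
    by (intro exI[of _ 0] exI[of _ "\<lambda>_. s0"]) simp
next
  fix u v assume "\<exists>n x. x n = u \<and> x 0 = s0 \<and> (\<forall>i<n. x (Suc i) \<in> set_pmf (P (x i)))"
    and v: "v \<in> set_pmf (P u)"
  then obtain n x where "x n = u" "x 0 = s0" "\<forall>i<n. x (Suc i) \<in> set_pmf (P (x i))" by blast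
  then show "\<exists>n x. x n = v \<and> x 0 = s0 \<and> (\<forall>i<n. x (Suc i) \<in> set_pmf (P (x i)))"
    using v by (intro exI[of _ "Suc n"] exI[of _ "x(Suc n := v)"]) (auto simp: less_Suc_eq)
qed

text \<open>A cylinder that leads from \<open>s0\<close> to \<open>s\<close> and across the edge to
  \<open>t\<close> has positive probability. On it all partial sums from \<open>Suc n\<close> on are
  infinite.\<close>

lemma infinite_weight_not_convergent:
  assumes "(s, t) \<in> edges S P" "W (s, t) = \<infinity>"
  shows "\<not> almost_surely_convergent S P W s0"
proof
  assume "almost_surely_convergent S P W s0"
  then have conv: "AE \<sigma> in path_measure P s0. \<sigma> \<in>
      {\<sigma> \<in> paths S P s0. (\<lambda>n. \<Sum>i<n. W (\<sigma> i, \<sigma> (Suc i))) \<longlonglongrightarrow> -\<infinity>}"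
    unfolding almost_surely_convergent_def by (rule path.AE_prob_1)
  have st: "s \<in> S" "t \<in> set_pmf (P s)" using assms by (auto simp: edges_iff)
  obtain n x where x: "x n = s" "x 0 = s0" "\<forall>i<n. x (Suc i) \<in> set_pmf (P (x i))"
    using reachable_from_start[OF st(1)] by blast
  define x' where "x' = x(Suc n := t)"
  let ?C = "{\<sigma>. \<forall>i\<le>Suc n. \<sigma> i = x' i}"
  have "x' 0 = s0" "\<forall>i<Suc n. pmf (P (x' i)) (x' (Suc i)) > 0"
    using x st by (auto simp: x'_def less_Suc_eq pmf_positive_iff)
  moreover from this have "(\<Prod>i<Suc n. pmf (P (x' i)) (x' (Suc i))) > 0"
    by (intro prod_pos) auto
  ultimately have "emeasure (path_measure P s0) ?C \<noteq> 0"
    unfolding emeasure_path_measure_cylinder by (simp only: if_True ennreal_eq_0_iff not_le simp_thms)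
  moreover have "AE \<sigma> in path_measure P s0. \<sigma> \<notin> ?C"
    using conv
  proof eventually_elim
    fix \<sigma>
    assume "\<sigma> \<in> {\<sigma> \<in> paths S P s0. (\<lambda>n. \<Sum>i<n. W (\<sigma> i, \<sigma> (Suc i))) \<longlonglongrightarrow> -\<infinity>}"
    then have "\<forall>\<^sub>F m in sequentially. (\<Sum>i<m. W (\<sigma> i, \<sigma> (Suc i))) < ereal 0"
      unfolding tendsto_MInfty mem_Collect_eq by blast
    then obtain N where N: "\<And>m. m \<ge> N \<Longrightarrow> (\<Sum>i<m. W (\<sigma> i, \<sigma> (Suc i))) < ereal 0"
      by (auto simp: eventually_sequentially)
    show "\<sigma> \<notin> ?C"
    proof
      assume "\<sigma> \<in> ?C"
      then have "\<sigma> n = x' n" "\<sigma> (Suc n) = x' (Suc n)" by auto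
      then have "W (\<sigma> n, \<sigma> (Suc n)) = \<infinity>" using assms x by (simp add: x'_def)
      \<comment> \<open>The length \<open>N + Suc n\<close> is at least \<open>N\<close> and
        includes index \<open>n\<close>. In \<open>ereal\<close> a summand
        \<open>\<infinity>\<close> absorbs all others.\<close>
      then have "(\<Sum>i<N + Suc n. W (\<sigma> i, \<sigma> (Suc i))) = \<infinity>"
        unfolding sum_Pinfty by (intro conjI bexI[of _ n]) auto
      with N[of "N + Suc n"] show False by (simp del: sum.lessThan_Suc)
    qed
  qed
  ultimately show False
    using AE_iff_measurable[OF cylinder_in_sets[of "Suc n" x' P s0], of "\<lambda>\<sigma>. \<sigma> \<notin> ?C"] by simp
qed

text \<open>The potential \<open>f\<close> telescopes: \<open>walk\<close> and the weight sum differ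
  by \<open>f (\<sigma> n) - f (\<sigma> 0)\<close>, which is bounded because the path stays in the
  finite set \<open>S\<close>.\<close>

lemma almost_surely_convergent_iff_walk:
  fixes f :: "'s \<Rightarrow> real"
  assumes W: "\<And>e. e \<in> edges S P \<Longrightarrow> W e = ereal (w e)"
    and y: "y = (\<lambda>s t. if s \<in> S \<and> t \<in> S then w (s, t) + f t - f s else 0)"
  shows "almost_surely_convergent S P W s0 \<longleftrightarrow>
    (AE \<sigma> in path_measure P s0. filterlim (\<lambda>n. walk y n \<sigma>) at_bot sequentially)"
proof -
  let ?M = "path_measure P s0"
  have conv_iff: "(\<lambda>n. \<Sum>i<n. W (\<sigma> i, \<sigma> (Suc i))) \<longlonglongrightarrow> -\<infinity> \<longleftrightarrow>
      filterlim (\<lambda>n. walk y n \<sigma>) at_bot sequentially" if \<sigma>: "\<sigma> \<in> paths S P s0" for \<sigma>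
  proof -
    let ?X = "\<lambda>n. \<Sum>i<n. w (\<sigma> i, \<sigma> (Suc i))"
    have "(\<Sum>i<n. W (\<sigma> i, \<sigma> (Suc i))) = ereal (?X n)" for n
      using \<sigma> by (subst sum_ereal[symmetric], intro sum.cong refl W) (auto simp: paths_def)
    then have "(\<lambda>n. \<Sum>i<n. W (\<sigma> i, \<sigma> (Suc i))) \<longlonglongrightarrow> -\<infinity> \<longleftrightarrow> filterlim ?X at_bot sequentially"
      by (simp add: tendsto_MInfty filterlim_at_bot_dense)
    also have "\<dots> \<longleftrightarrow> filterlim (\<lambda>n. walk y n \<sigma>) at_bot sequentially"
    proof -
      have walk_eq: "walk y n \<sigma> = ?X n + f (\<sigma> n) - f (\<sigma> 0)" for n
        using paths_in_S[OF \<sigma>] by (induction n) (auto simp: walk_def y)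
      have f_bound: "\<bar>f (\<sigma> n)\<bar> \<le> (\<Sum>s\<in>S. \<bar>f s\<bar>)" for n
        using paths_in_S[OF \<sigma>] finite_S by (intro member_le_sum[of _ S "\<lambda>s. \<bar>f s\<bar>"]) auto
      have diff: "\<bar>walk y n \<sigma> - ?X n\<bar> \<le> 2 * (\<Sum>s\<in>S. \<bar>f s\<bar>)" for n
        using f_bound[of n] f_bound[of 0] unfolding walk_eq by linarith
      show ?thesis
        using filterlim_at_bot_bounded_diff[of ?X _ "\<lambda>n. walk y n \<sigma>", OF _ diff]
          filterlim_at_bot_bounded_diff[of "\<lambda>n. walk y n \<sigma>" _ ?X, OF _ diff[unfolded abs_minus_commute[of "walk y _ \<sigma>"]]]
        by blast
    qed
    finally show ?thesis .
  qed
  let ?A = "{\<sigma> \<in> paths S P s0. filterlim (\<lambda>n. walk y n \<sigma>) at_bot sequentially}"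
  \<comment> \<open>Countable quantifiers make the event measurable; only then does
    \<open>measure = 1\<close> translate into an almost-everywhere statement.\<close>
  have bot_iff: "filterlim (\<lambda>n. walk y n \<sigma>) at_bot sequentially \<longleftrightarrow>
      (\<forall>k::nat. \<exists>N. \<forall>n\<ge>N. walk y n \<sigma> \<le> - real k)" for \<sigma>
  proof
    assume *: "\<forall>k::nat. \<exists>N. \<forall>n\<ge>N. walk y n \<sigma> \<le> - real k"
    show "filterlim (\<lambda>n. walk y n \<sigma>) at_bot sequentially"
      unfolding filterlim_at_bot
    proof
      fix Z :: real
      obtain k :: nat where k: "- Z \<le> k" using real_arch_simple by blast
      obtain N where "\<And>n. n \<ge> N \<Longrightarrow> walk y n \<sigma> \<le> - real k" using * by blast
      then have "walk y n \<sigma> \<le> Z" if "n \<ge> N" for n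
        using that k by (meson order_trans minus_le_iff)
      then show "\<forall>\<^sub>F n in sequentially. walk y n \<sigma> \<le> Z"
        by (auto simp: eventually_sequentially)
    qed
  qed (auto simp: filterlim_at_bot eventually_sequentially)
  have [measurable]: "walk y n \<in> borel_measurable ?M" for n
    by (rule measurable_walk) (auto simp: y)
  have "{\<sigma> \<in> space ?M. \<forall>k::nat. \<exists>N. \<forall>n\<ge>N. walk y n \<sigma> \<le> - real k} \<in> sets ?M"
    by measurable
  then have "paths S P s0 \<inter> {\<sigma>. \<forall>k::nat. \<exists>N. \<forall>n\<ge>N. walk y n \<sigma> \<le> - real k} \<in> sets ?M"
    using paths_in_sets by (intro sets.Int) simp_all
  moreover have "?A = paths S P s0 \<inter> {\<sigma>. \<forall>k::nat. \<exists>N. \<forall>n\<ge>N. walk y n \<sigma> \<le> - real k}"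
    unfolding bot_iff by blast
  ultimately have "?A \<in> sets ?M" by (simp only:)
  have "{\<sigma> \<in> paths S P s0. (\<lambda>n. \<Sum>i<n. W (\<sigma> i, \<sigma> (Suc i))) \<longlonglongrightarrow> -\<infinity>} = ?A"
    using conv_iff by blast
  then have "almost_surely_convergent S P W s0 \<longleftrightarrow> measure ?M ?A = 1"
    by (simp add: almost_surely_convergent_def)
  also have "\<dots> \<longleftrightarrow> (AE \<sigma> in ?M. \<sigma> \<in> ?A)"
    using \<open>?A \<in> sets ?M\<close> by (rule path.prob_eq_1)
  also have "\<dots> \<longleftrightarrow> (AE \<sigma> in ?M. filterlim (\<lambda>n. walk y n \<sigma>) at_bot sequentially)"
    by (simp add: AE_paths)
  finally show ?thesis .
qed

text \<open>As \<open>0 * \<infinity> = 0\<close> in \<open>ereal\<close>, the infinite edge counts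
  only because its coefficient is positive, which \<open>stationary_pos\<close> guarantees.\<close>

lemma effective_weight_infinite:
  assumes "stationary_distribution S P \<rho>" "(s, t) \<in> edges S P" "W (s, t) = \<infinity>"
  shows "effective_weight S P W \<rho> = \<infinity>"
proof -
  have "pmf \<rho> s * pmf (P s) t > 0"
    using assms stationary_pos[OF assms(1)] by (auto simp: edges_def)
  then show ?thesis
    unfolding effective_weight_def sum_Pinfty
    using assms finite_edges by (intro conjI bexI[of _ "(s, t)"]) auto
qed

lemma effective_weight_real:
  assumes W: "\<And>e. e \<in> edges S P \<Longrightarrow> W e = ereal (w e)"
  shows "effective_weight S P W \<rho> =
    ereal (\<Sum>s\<in>S. pmf \<rho> s * (\<Sum>t\<in>S. pmf (P s) t * w (s, t)))"
proof -
  have "effective_weight S P W \<rho> =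
      (\<Sum>(s, t)\<in>edges S P. ereal (pmf \<rho> s * pmf (P s) t * w (s, t)))"
    unfolding effective_weight_def using W by (intro sum.cong) auto
  also have "\<dots> = ereal (\<Sum>(s, t)\<in>edges S P. pmf \<rho> s * pmf (P s) t * w (s, t))"
    by (simp add: case_prod_unfold)
  \<comment> \<open>Pairs in \<open>S \<times> S\<close> that are not edges have probability 0 and
    add nothing.\<close>
  also have "(\<Sum>(s, t)\<in>edges S P. pmf \<rho> s * pmf (P s) t * w (s, t)) =
      (\<Sum>(s, t)\<in>S \<times> S. pmf \<rho> s * pmf (P s) t * w (s, t))"
    using finite_S pmf_nonneg
    by (intro sum.mono_neutral_left) (auto simp: edges_def order.order_iff_strict)
  also have "\<dots> = (\<Sum>s\<in>S. pmf \<rho> s * (\<Sum>t\<in>S. pmf (P s) t * w (s, t)))"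
    by (simp add: sum_distrib_left mult.assoc flip: sum.cartesian_product)
  finally show ?thesis .
qed

lemma almost_surely_convergent_iff:
  assumes W: "\<And>e. e \<in> edges S P \<Longrightarrow> W e \<noteq> -\<infinity>"
    and \<rho>: "stationary_distribution S P \<rho>"
  shows "almost_surely_convergent S P W s0 \<longleftrightarrow> effective_weight S P W \<rho> < 0"
proof (cases "\<exists>s t. (s, t) \<in> edges S P \<and> W (s, t) = \<infinity>")
  case True
  then show ?thesis
    using infinite_weight_not_convergent effective_weight_infinite[OF \<rho>] by fastforce
next
  case False
  define w where "w e = real_of_ereal (W e)" for e
  have Ww: "W e = ereal (w e)" if "e \<in> edges S P" for e
    using W[OF that] that False by (cases e; cases "W e") (auto simp: w_def)
  \<comment> \<open>The expected weight of a step out of \<open>s\<close>; its stationary mean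
    \<open>\<omega>\<close> is the effective weight. The Poisson equation for \<open>g\<close>
    levels the drift to \<open>\<omega>\<close> in every state.\<close>
  define g where "g s = (\<Sum>t\<in>S. pmf (P s) t * w (s, t))" for s
  define \<omega> where "\<omega> = (\<Sum>s\<in>S. pmf \<rho> s * g s)"
  obtain f where f: "\<And>s. s \<in> S \<Longrightarrow> g s + (\<Sum>t\<in>S. pmf (P s) t * f t) - f s = \<omega>"
    using poisson_equation[OF \<rho>, of g] by (auto simp: \<omega>_def)
  \<comment> \<open>The value 0 off \<open>S\<close> meets the support condition of the lemmas on
    walks; paths never see it.\<close>
  define y where "y = (\<lambda>s t. if s \<in> S \<and> t \<in> S then w (s, t) + f t - f s else 0)"
  have supp: "y s t = 0" if "s \<notin> S \<or> t \<notin> S" for s t using that by (auto simp: y_def)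
  have drift: "(\<Sum>t\<in>S. pmf (P s) t * y s t) = \<omega>" if s: "s \<in> S" for s
  proof -
    have "(\<Sum>t\<in>S. pmf (P s) t * y s t) =
        (\<Sum>t\<in>S. pmf (P s) t * w (s, t) + pmf (P s) t * f t - pmf (P s) t * f s)"
      using s by (intro sum.cong) (auto simp: y_def algebra_simps)
    also have "\<dots> = g s + (\<Sum>t\<in>S. pmf (P s) t * f t) - (\<Sum>t\<in>S. pmf (P s) t) * f s"
      by (simp add: g_def sum.distrib sum_subtractf sum_distrib_right)
    also have "\<dots> = \<omega>" using f[OF s] sum_P[OF s] by simp
    finally show ?thesis .
  qed
  have "effective_weight S P W \<rho> = ereal \<omega>"
    using effective_weight_real[OF Ww] by (simp add: \<omega>_def g_def)
  moreover have "almost_surely_convergent S P W s0 \<longleftrightarrow>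
      (AE \<sigma> in path_measure P s0. filterlim (\<lambda>n. walk y n \<sigma>) at_bot sequentially)"
    using Ww y_def by (rule almost_surely_convergent_iff_walk)
  moreover have "\<dots> \<longleftrightarrow> \<omega> < 0"
    using negative_drift_walk[OF supp drift] nonnegative_drift_walk[OF supp drift] by fastforce
  ultimately show ?thesis by simp
qed

end

theorem theorem3:
  fixes S :: "'s set"
    and P :: "'s \<Rightarrow> 's pmf"
    and W :: "'s \<times> 's \<Rightarrow> ereal"
    and s_init :: 's
    and \<rho> :: "'s pmf"
  assumes "wdtmc S P W"
    and "finite S"
    and "irreducible_chain S P"
    and "aperiodic_chain S P"
    and "s_init \<in> S"
    and "stationary_distribution S P \<rho>"
  shows "almost_surely_convergent S P W s_init \<longleftrightarrow> effective_weight S P W \<rho> < 0"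
proof -
  interpret started_chain S P s_init
    by standard (use assms in \<open>auto simp: wdtmc_def\<close>)
  show ?thesis
    using assms by (intro almost_surely_convergent_iff) (auto simp: wdtmc_def)
qed

end
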